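(* Let $v$ be a Morse flow on a closed manifold $M$. Then the CW decomposition $\{W^u(x) : x\in\mathrm{Sing}(v)\}$ of unstable manifolds of singular points is a quotient of the abstract weak orbit space $M/[v]$; that is, each $W^u(x)$, $x\in\mathrm{Sing}(v)$, is a union of abstract weak orbits of $v$. Moreover, the set $\{W^u(x)\cap W^s(y): x,y\in\mathrm{Sing}(v)\}$ of connecting orbit sets of singular points is also a quotient of $M/[v]$; that is, each $W^u(x)\cap W^s(y)$ is a union of abstract weak orbits of $v$.
   Context: A flow on a space $X$ is a continuous $\mathbb{R}$-action $v$, $v_t=v(t,\cdot)$; $O(x)=\{v_t(x): t\in\mathbb{R}\}$. $\omega(x)=\bigcap_{n\in\mathbb{R}}\overline{\{v_t(x): t>n\}}$, $\alpha(x)=\bigcap_{n\in\mathbb{R}}\overline{\{v_t(x): t<n\}}$. $x$ is singular if $v_t(x)=x$ for all $t$; periodic if there is $T>0$ with $v_T(x)=x$ and $v_t(x)\neq x$ for $t\in(0,T)$; a closed orbit is a singular or periodic orbit. $\mathrm{Sing}(v)$, $\mathrm{Per}(v)$ are the sets of singular and periodic points, $\mathrm{Cl}(v)$ their union. $x$ is recurrent if $x\in\alpha(x)\cup\omega(x)$; $\mathrm{R}(v)$ is the set of recurrent points not in $\mathrm{Cl}(v)$; $\mathrm{P}(v)$ is the set of non-recurrent points. Abstract weak orbits: $\alpha'(x)=\alpha(x)\setminus O(x)$, $\omega'(x)=\omega(x)\setminus O(x)$; $[x]'$ is the connected component containing $x$ of $\{y:\alpha'(y)=\alpha'(x),\omega'(y)=\omega'(x)\}$;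 $[x]''$ is the connected component containing $x$ of $[x]'\cap Z$, where $Z$ is the one of $\mathrm{Sing}(v),\mathrm{Per}(v),\mathrm{P}(v),\mathrm{R}(v)$ containing $x$; $\check O(x)=\{y:\overline{O(y)}=\overline{O(x)},\alpha(y)=\alpha(x),\omega(y)=\omega(x)\}$. The abstract weak orbit is $[x]=[x]''$ if $x\notin \mathrm{R}(v)$ and $[x]=\check O(x)$ if $x\in\mathrm{R}(v)$. These sets partition the space, and $M/[v]$ is the quotient space. $W^u(x)=\{y:\alpha(y)\subseteq\{x\}\}$ and $W^s(x)=\{y:\omega(y)\subseteq\{x\}\}$ for a singular point $x$. A point is wandering if it has a neighborhood $U$ and there is $N>0$ with $v_t(U)\cap U=\emptyset$ for all $t>N$; the non-wandering set $\Omega(v)$ is the set of non-wandering points. A Morse-Smale flow on a closed manifold is a flow topologically equivalent (by a homeomorphism mapping orbits to orbits preserving direction) to the flow of a $C^\infty$ vector field whose non-wandering set consists of finitely many hyperbolic closed orbits, such that the stable and unstable manifolds of any two closed orbits are transverse. A limit cycle is a periodic orbit which is the $\alpha$- or $\omega$-limit set of a point not on it. A Morse flow is a Morse-Smale flow without limit cycles. It is known (Abbondandolo–Majer) that for a Morse flow on a closed manifold the set of unstable manifolds of singular points is a finite CW decomposition. *)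

theory Defs
  imports "HOL-Analysis.Analysis"
begin

section \<open>Flows\<close>

definition flow :: "'a topology \<Rightarrow> (real \<Rightarrow> 'a \<Rightarrow> 'a) \<Rightarrow> bool" where
  "flow M v \<longleftrightarrow>
     continuous_map (prod_topology euclideanreal M) M (\<lambda>(t, x). v t x) \<and>
     (\<forall>x\<in>topspace M. v 0 x = x) \<and>
     (\<forall>x\<in>topspace M. \<forall>s t. v (s + t) x = v s (v t x))"

definition orbit :: "(real \<Rightarrow> 'a \<Rightarrow> 'a) \<Rightarrow> 'a \<Rightarrow> 'a set" where
  "orbit v x = range (\<lambda>t. v t x)"

definition omega_limit :: "'a topology \<Rightarrow> (real \<Rightarrow> 'a \<Rightarrow> 'a) \<Rightarrow> 'a \<Rightarrow> 'a set" where
  "omega_limit M v x = (\<Inter>n::real. M closure_of {v t x |t. t > n})"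

definition alpha_limit :: "'a topology \<Rightarrow> (real \<Rightarrow> 'a \<Rightarrow> 'a) \<Rightarrow> 'a \<Rightarrow> 'a set" where
  "alpha_limit M v x = (\<Inter>n::real. M closure_of {v t x |t. t < n})"

definition Sing :: "'a topology \<Rightarrow> (real \<Rightarrow> 'a \<Rightarrow> 'a) \<Rightarrow> 'a set" where
  "Sing M v = {x \<in> topspace M. \<forall>t. v t x = x}"

definition has_period :: "(real \<Rightarrow> 'a \<Rightarrow> 'a) \<Rightarrow> 'a \<Rightarrow> real \<Rightarrow> bool" where
  "has_period v x T \<longleftrightarrow> T > 0 \<and> v T x = x \<and> (\<forall>t\<in>{0<..<T}. v t x \<noteq> x)"

definition Per :: "'a topology \<Rightarrow> (real \<Rightarrow> 'a \<Rightarrow> 'a) \<Rightarrow> 'a set" where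
  "Per M v = {x \<in> topspace M. \<exists>T. has_period v x T}"

definition Cl :: "'a topology \<Rightarrow> (real \<Rightarrow> 'a \<Rightarrow> 'a) \<Rightarrow> 'a set" where
  "Cl M v = Sing M v \<union> Per M v"

definition closed_orbits :: "'a topology \<Rightarrow> (real \<Rightarrow> 'a \<Rightarrow> 'a) \<Rightarrow> 'a set set" where
  "closed_orbits M v = orbit v ` Cl M v"

definition recurrent :: "'a topology \<Rightarrow> (real \<Rightarrow> 'a \<Rightarrow> 'a) \<Rightarrow> 'a \<Rightarrow> bool" where
  "recurrent M v x \<longleftrightarrow> x \<in> alpha_limit M v x \<union> omega_limit M v x"

definition Rec :: "'a topology \<Rightarrow> (real \<Rightarrow> 'a \<Rightarrow> 'a) \<Rightarrow> 'a set" where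
  "Rec M v = {x \<in> topspace M. recurrent M v x} - Cl M v"

definition NonRec :: "'a topology \<Rightarrow> (real \<Rightarrow> 'a \<Rightarrow> 'a) \<Rightarrow> 'a set" where
  "NonRec M v = {x \<in> topspace M. \<not> recurrent M v x}"

definition wandering :: "'a topology \<Rightarrow> (real \<Rightarrow> 'a \<Rightarrow> 'a) \<Rightarrow> 'a \<Rightarrow> bool" where
  "wandering M v x \<longleftrightarrow>
     (\<exists>U. openin M U \<and> x \<in> U \<and> (\<exists>N>0. \<forall>t>N. v t ` U \<inter> U = {}))"

definition nonwandering_set :: "'a topology \<Rightarrow> (real \<Rightarrow> 'a \<Rightarrow> 'a) \<Rightarrow> 'a set" where
  "nonwandering_set M v = {x \<in> topspace M. \<not> wandering M v x}"

text \<open>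
  The stable and unstable sets of a set \<open>C\<close>. It is applied to closed orbits; the paper's
  \<open>W^s(x)\<close> and \<open>W^u(x)\<close> of a singular point are the case \<open>C = {x}\<close>.
\<close>

definition stable_set :: "'a topology \<Rightarrow> (real \<Rightarrow> 'a \<Rightarrow> 'a) \<Rightarrow> 'a set \<Rightarrow> 'a set" where
  "stable_set M v C = {y \<in> topspace M. omega_limit M v y \<subseteq> C}"

definition unstable_set :: "'a topology \<Rightarrow> (real \<Rightarrow> 'a \<Rightarrow> 'a) \<Rightarrow> 'a set \<Rightarrow> 'a set" where
  "unstable_set M v C = {y \<in> topspace M. alpha_limit M v y \<subseteq> C}"

text \<open>
  Orbits are mapped onto orbits, and the direction is preserved in the sense that the time
  parameter along each orbit is changed by an increasing bijection of the real line (which is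
  automatically a homeomorphism).
\<close>

definition topologically_equivalent ::
    "'a topology \<Rightarrow> (real \<Rightarrow> 'a \<Rightarrow> 'a) \<Rightarrow> 'b topology \<Rightarrow> (real \<Rightarrow> 'b \<Rightarrow> 'b) \<Rightarrow> bool" where
  "topologically_equivalent M v N w \<longleftrightarrow>
     (\<exists>h. homeomorphic_map M N h \<and>
        (\<forall>x\<in>topspace M. h ` orbit v x = orbit w (h x) \<and>
           (\<exists>\<tau>::real \<Rightarrow> real. strict_mono \<tau> \<and> surj \<tau> \<and> (\<forall>t. h (v t x) = w (\<tau> t) (h x)))))"

section \<open>Abstract weak orbits\<close>

definition alpha_limit' :: "'a topology \<Rightarrow> (real \<Rightarrow> 'a \<Rightarrow> 'a) \<Rightarrow> 'a \<Rightarrow> 'a set" where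
  "alpha_limit' M v x = alpha_limit M v x - orbit v x"

definition omega_limit' :: "'a topology \<Rightarrow> (real \<Rightarrow> 'a \<Rightarrow> 'a) \<Rightarrow> 'a \<Rightarrow> 'a set" where
  "omega_limit' M v x = omega_limit M v x - orbit v x"

definition weak_class' :: "'a topology \<Rightarrow> (real \<Rightarrow> 'a \<Rightarrow> 'a) \<Rightarrow> 'a \<Rightarrow> 'a set" where
  "weak_class' M v x =
     connected_component_of_set
       (subtopology M {y \<in> topspace M. alpha_limit' M v y = alpha_limit' M v x \<and>
                                       omega_limit' M v y = omega_limit' M v x}) x"

text \<open>The one of the four pairwise disjoint sets \<open>Sing\<close>, \<open>Per\<close>, \<open>NonRec\<close>, \<open>Rec\<close> that contains \<open>x\<close>.\<close>

definition point_kind :: "'a topology \<Rightarrow> (real \<Rightarrow> 'a \<Rightarrow> 'a) \<Rightarrow> 'a \<Rightarrow> 'a set" where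
  "point_kind M v x =
     (if x \<in> Sing M v then Sing M v
      else if x \<in> Per M v then Per M v
      else if x \<in> NonRec M v then NonRec M v
      else Rec M v)"

definition weak_class'' :: "'a topology \<Rightarrow> (real \<Rightarrow> 'a \<Rightarrow> 'a) \<Rightarrow> 'a \<Rightarrow> 'a set" where
  "weak_class'' M v x =
     connected_component_of_set (subtopology M (weak_class' M v x \<inter> point_kind M v x)) x"

definition check_orbit :: "'a topology \<Rightarrow> (real \<Rightarrow> 'a \<Rightarrow> 'a) \<Rightarrow> 'a \<Rightarrow> 'a set" where
  "check_orbit M v x =
     {y \<in> topspace M. M closure_of orbit v y = M closure_of orbit v x \<and>
        alpha_limit M v y = alpha_limit M v x \<and> omega_limit M v y = omega_limit M v x}"

definition abstract_weak_orbit :: "'a topology \<Rightarrow> (real \<Rightarrow> 'a \<Rightarrow> 'a) \<Rightarrow> 'a \<Rightarrow> 'a set" where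
  "abstract_weak_orbit M v x =
     (if x \<in> Rec M v then check_orbit M v x else weak_class'' M v x)"

text \<open>The points of the quotient space \<open>M/[v]\<close>.\<close>

definition abstract_weak_orbit_space :: "'a topology \<Rightarrow> (real \<Rightarrow> 'a \<Rightarrow> 'a) \<Rightarrow> 'a set set" where
  "abstract_weak_orbit_space M v = abstract_weak_orbit M v ` topspace M"

section \<open>Smooth maps and closed manifolds\<close>

text \<open>For open \<open>S\<close> in a finite-dimensional space this is the usual class \<open>C^k\<close>.\<close>

primrec Ck_on ::
    "nat \<Rightarrow> 'a::real_normed_vector set \<Rightarrow> ('a \<Rightarrow> 'b::real_normed_vector) \<Rightarrow> bool" where
  "Ck_on 0 S f \<longleftrightarrow> continuous_on S f"
| "Ck_on (Suc k) S f \<longleftrightarrow>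
     (\<forall>x\<in>S. f differentiable at x) \<and> (\<forall>\<xi>. Ck_on k S (\<lambda>x. frechet_derivative f (at x) \<xi>))"

definition smooth_on :: "'a::real_normed_vector set \<Rightarrow> ('a \<Rightarrow> 'b::real_normed_vector) \<Rightarrow> bool" where
  "smooth_on S f \<longleftrightarrow> (\<forall>k. Ck_on k S f)"

text \<open>
  A chart is a pair of its domain and its coordinate map. Charts take values in a
  finite-dimensional normed space \<open>'e\<close>, whose dimension is that of the manifold; all norms on
  such a space are equivalent. The class of Euclidean spaces is not used for \<open>'e\<close> because it
  excludes dimension zero.
\<close>

type_synonym ('a, 'e) chart = "'a set \<times> ('a \<Rightarrow> 'e)"

definition is_chart :: "'a topology \<Rightarrow> ('a, 'e::real_normed_vector) chart \<Rightarrow> bool" where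
  "is_chart M c \<longleftrightarrow>
     openin M (fst c) \<and> open (snd c ` fst c) \<and>
     homeomorphic_map (subtopology M (fst c)) (top_of_set (snd c ` fst c)) (snd c)"

definition chart_inv :: "('a, 'e) chart \<Rightarrow> 'e \<Rightarrow> 'a" where
  "chart_inv c = inv_into (fst c) (snd c)"

definition closed_manifold :: "'e::real_normed_vector itself \<Rightarrow> 'a topology \<Rightarrow> bool" where
  "closed_manifold _ M \<longleftrightarrow>
     (\<exists>B::'e set. finite B \<and> span B = UNIV) \<and>
     compact_space M \<and> Hausdorff_space M \<and> second_countable M \<and>
     (\<forall>x\<in>topspace M. \<exists>c::('a, 'e) chart. is_chart M c \<and> x \<in> fst c)"

definition smooth_atlas :: "'a topology \<Rightarrow> ('a, 'e::real_normed_vector) chart set \<Rightarrow> bool" where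
  "smooth_atlas M A \<longleftrightarrow>
     (\<forall>c\<in>A. is_chart M c) \<and> (\<Union>c\<in>A. fst c) = topspace M \<and>
     (\<forall>c\<in>A. \<forall>d\<in>A. smooth_on (snd c ` (fst c \<inter> fst d)) (\<lambda>u. snd d (chart_inv c u)))"

text \<open>
  A tangent vector is represented by its coordinates in each chart. So a vector field \<open>X\<close> is
  given by its coordinate expressions \<open>X c p\<close>, which transform under a change of chart by the
  derivative of the transition map.
\<close>

definition smooth_vector_field ::
    "('a, 'e::real_normed_vector) chart set \<Rightarrow> (('a, 'e) chart \<Rightarrow> 'a \<Rightarrow> 'e) \<Rightarrow> bool" where
  "smooth_vector_field A X \<longleftrightarrow>
     (\<forall>c\<in>A. smooth_on (snd c ` fst c) (\<lambda>u. X c (chart_inv c u))) \<and>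
     (\<forall>c\<in>A. \<forall>d\<in>A. \<forall>p \<in> fst c \<inter> fst d.
        X d p = frechet_derivative (\<lambda>u. snd d (chart_inv c u)) (at (snd c p)) (X c p))"

definition flow_of_vector_field ::
    "'a topology \<Rightarrow> ('a, 'e::real_normed_vector) chart set \<Rightarrow> (('a, 'e) chart \<Rightarrow> 'a \<Rightarrow> 'e) \<Rightarrow>
     (real \<Rightarrow> 'a \<Rightarrow> 'a) \<Rightarrow> bool" where
  "flow_of_vector_field M A X v \<longleftrightarrow>
     flow M v \<and>
     (\<forall>p\<in>topspace M. \<forall>t. \<forall>c\<in>A. v t p \<in> fst c \<longrightarrow>
        ((\<lambda>s. snd c (v s p)) has_vector_derivative X c (v t p)) (at t))"

section \<open>Hyperbolicity\<close>

text \<open>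
  \<open>z\<close> is an eigenvalue of the complexification of the linear map that \<open>L\<close> induces on the quotient
  of \<open>'e\<close> by the \<open>L\<close>-invariant subspace \<open>K\<close>. The pair \<open>(a, b)\<close> stands for the vector \<open>a + \<i> b\<close>,
  which is nonzero modulo the complexification of \<open>K\<close>. For \<open>K = {0}\<close> these are the complex
  eigenvalues of \<open>L\<close> itself.
\<close>

definition eigenvalue_mod :: "'e::real_vector set \<Rightarrow> ('e \<Rightarrow> 'e) \<Rightarrow> complex \<Rightarrow> bool" where
  "eigenvalue_mod K L z \<longleftrightarrow>
     (\<exists>a b. \<not> (a \<in> K \<and> b \<in> K) \<and>
        L a - (Re z *\<^sub>R a - Im z *\<^sub>R b) \<in> K \<and>
        L b - (Im z *\<^sub>R a + Re z *\<^sub>R b) \<in> K)"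

definition hyperbolic_singular ::
    "('a, 'e::real_normed_vector) chart set \<Rightarrow> (('a, 'e) chart \<Rightarrow> 'a \<Rightarrow> 'e) \<Rightarrow> 'a \<Rightarrow> bool" where
  "hyperbolic_singular A X p \<longleftrightarrow>
     (\<forall>c\<in>A. p \<in> fst c \<longrightarrow>
        (\<forall>z. eigenvalue_mod {0}
                (frechet_derivative (\<lambda>u. X c (chart_inv c u)) (at (snd c p))) z \<longrightarrow> Re z \<noteq> 0))"

text \<open>
  The derivative of \<open>v T\<close> at a point \<open>p\<close> of period \<open>T\<close> fixes the direction of the vector field, and
  the map it induces on the quotient by this line is the derivative of the Poincare map.
\<close>

definition hyperbolic_periodic ::
    "('a, 'e::real_normed_vector) chart set \<Rightarrow> (('a, 'e) chart \<Rightarrow> 'a \<Rightarrow> 'e) \<Rightarrow>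
     (real \<Rightarrow> 'a \<Rightarrow> 'a) \<Rightarrow> 'a \<Rightarrow> real \<Rightarrow> bool" where
  "hyperbolic_periodic A X v p T \<longleftrightarrow>
     (\<forall>c\<in>A. p \<in> fst c \<longrightarrow>
        (\<forall>z. eigenvalue_mod (span {X c p})
                (frechet_derivative (\<lambda>u. snd c (v T (chart_inv c u))) (at (snd c p))) z
             \<longrightarrow> cmod z \<noteq> 1))"

definition hyperbolic_orbit ::
    "'a topology \<Rightarrow> ('a, 'e::real_normed_vector) chart set \<Rightarrow> (('a, 'e) chart \<Rightarrow> 'a \<Rightarrow> 'e) \<Rightarrow>
     (real \<Rightarrow> 'a \<Rightarrow> 'a) \<Rightarrow> 'a set \<Rightarrow> bool" where
  "hyperbolic_orbit M A X v C \<longleftrightarrow>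
     (\<forall>p\<in>C. (p \<in> Sing M v \<longrightarrow> hyperbolic_singular A X p) \<and>
             (\<forall>T. has_period v p T \<longrightarrow> hyperbolic_periodic A X v p T))"

section \<open>Transversality of stable and unstable manifolds\<close>

text \<open>
  The tangent space at \<open>q\<close> of the stable manifold of a hyperbolic closed orbit \<open>C\<close>, in the
  coordinates of the chart \<open>c\<close>. The stable manifold is in general only an immersed submanifold
  (an increasing union of preimages under the flow of the embedded local stable manifold), and its
  tangent vectors are the velocities of the smooth curves that are smooth for its own manifold
  structure, not merely contained in it. These are the curves that the flow carries into every
  neighbourhood of \<open>C\<close> uniformly: points staying close to \<open>C\<close> in the future form
  the local stable manifold.
\<close>

definition stable_tangent ::
    "'a topology \<Rightarrow> (real \<Rightarrow> 'a \<Rightarrow> 'a) \<Rightarrow> 'a set \<Rightarrow> ('a, 'e::real_normed_vector) chart \<Rightarrow> 'a \<Rightarrow>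
     'e set" where
  "stable_tangent M v C c q =
     {\<xi>. \<exists>\<kappa>::real \<Rightarrow> 'a. \<kappa> 0 = q \<and> range \<kappa> \<subseteq> fst c \<and>
          smooth_on UNIV (\<lambda>s. snd c (\<kappa> s)) \<and>
          ((\<lambda>s. snd c (\<kappa> s)) has_vector_derivative \<xi>) (at 0) \<and>
          (\<forall>U. openin M U \<and> C \<subseteq> U \<longrightarrow> (\<exists>T. \<forall>t\<ge>T. \<forall>s. v t (\<kappa> s) \<in> U))}"

definition unstable_tangent ::
    "'a topology \<Rightarrow> (real \<Rightarrow> 'a \<Rightarrow> 'a) \<Rightarrow> 'a set \<Rightarrow> ('a, 'e::real_normed_vector) chart \<Rightarrow> 'a \<Rightarrow>
     'e set" where
  "unstable_tangent M v C c q = stable_tangent M (\<lambda>t. v (- t)) C c q"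

definition transverse_stable_unstable ::
    "'a topology \<Rightarrow> ('a, 'e::real_normed_vector) chart set \<Rightarrow> (real \<Rightarrow> 'a \<Rightarrow> 'a) \<Rightarrow>
     'a set \<Rightarrow> 'a set \<Rightarrow> bool" where
  "transverse_stable_unstable M A v C D \<longleftrightarrow>
     (\<forall>q \<in> stable_set M v C \<inter> unstable_set M v D. \<forall>c\<in>A. q \<in> fst c \<longrightarrow>
        {\<xi> + \<eta> |\<xi> \<eta>. \<xi> \<in> stable_tangent M v C c q \<and> \<eta> \<in> unstable_tangent M v D c q} = UNIV)"

section \<open>Morse--Smale and Morse flows\<close>

definition smooth_morse_smale ::
    "'a topology \<Rightarrow> ('a, 'e::real_normed_vector) chart set \<Rightarrow> (('a, 'e) chart \<Rightarrow> 'a \<Rightarrow> 'e) \<Rightarrow>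
     (real \<Rightarrow> 'a \<Rightarrow> 'a) \<Rightarrow> bool" where
  "smooth_morse_smale M A X v \<longleftrightarrow>
     smooth_atlas M A \<and> smooth_vector_field A X \<and> flow_of_vector_field M A X v \<and>
     (\<exists>\<C>. finite \<C> \<and> \<C> \<subseteq> closed_orbits M v \<and> (\<forall>C\<in>\<C>. hyperbolic_orbit M A X v C) \<and>
          nonwandering_set M v = \<Union>\<C>) \<and>
     (\<forall>C\<in>closed_orbits M v. \<forall>D\<in>closed_orbits M v. transverse_stable_unstable M A v C D)"

text \<open>
  The smooth model is another closed manifold \<open>N\<close>. That its points have the same type as those of
  \<open>M\<close> is no restriction: the smooth structure can be transported to \<open>M\<close> along the homeomorphism.
\<close>

definition morse_smale_flow ::
    "'e::real_normed_vector itself \<Rightarrow> 'a topology \<Rightarrow> (real \<Rightarrow> 'a \<Rightarrow> 'a) \<Rightarrow> bool" where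
  "morse_smale_flow E M v \<longleftrightarrow>
     closed_manifold E M \<and> flow M v \<and>
     (\<exists>(N::'a topology) (A::('a, 'e) chart set) X w.
        closed_manifold E N \<and> smooth_morse_smale N A X w \<and> topologically_equivalent M v N w)"

definition limit_cycle :: "'a topology \<Rightarrow> (real \<Rightarrow> 'a \<Rightarrow> 'a) \<Rightarrow> 'a set \<Rightarrow> bool" where
  "limit_cycle M v C \<longleftrightarrow>
     C \<in> orbit v ` Per M v \<and>
     (\<exists>y \<in> topspace M - C. alpha_limit M v y = C \<or> omega_limit M v y = C)"

definition morse_flow ::
    "'e::real_normed_vector itself \<Rightarrow> 'a topology \<Rightarrow> (real \<Rightarrow> 'a \<Rightarrow> 'a) \<Rightarrow> bool" where
  "morse_flow E M v \<longleftrightarrow> morse_smale_flow E M v \<and> (\<nexists>C. limit_cycle M v C)"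

end

(* Limit sets are invariant, so those of a nonrecurrent point are disjoint from its orbit: on NonRec
   the primed limit sets agree with the limit sets, while on Rec an abstract weak orbit fixes both
   limit sets by definition. A singular point is nonwandering, so Sing is finite and its abstract
   weak orbits are points. A periodic point belongs to its own alpha-limit set, hence to no unstable
   set of a singular point. *)
theory Submission
  imports Defs
begin

section \<open>Time maps and time reversal\<close>

lemma flow_continuous_map:
  assumes "flow M v"
  shows "continuous_map M M (v t)"
proof -
  have "continuous_map M (prod_topology euclideanreal M) (\<lambda>x. (t, x))"
    by (intro continuous_map_pairedI) auto
  from continuous_map_compose[OF this, of M "\<lambda>(t, x). v t x"] show ?thesis
    using assms by (simp add: flow_def o_def)
qed

lemma flow_reverse:
  assumes "flow M v"
  shows "flow M (\<lambda>t. v (- t))"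
proof -
  have "continuous_map (prod_topology euclideanreal M) (prod_topology euclideanreal M)
          (\<lambda>p. (- fst p, snd p))"
    by (intro continuous_map_pairedI continuous_map_snd continuous_map_minus continuous_map_fst)
  from continuous_map_compose[OF this, of M "\<lambda>(t, x). v t x"]
  have "continuous_map (prod_topology euclideanreal M) M (\<lambda>(t, x). v (- t) x)"
    using assms by (simp add: flow_def o_def case_prod_unfold)
  moreover have "v (- (s + t)) x = v (- s) (v (- t) x)" if "x \<in> topspace M" for s t x
  proof -
    have "v (- s + - t) x = v (- s) (v (- t) x)"
      using assms that unfolding flow_def by blast
    then show ?thesis
      by simp
  qed
  moreover have "v (- 0) x = x" if "x \<in> topspace M" for x
    using assms that by (simp add: flow_def)
  ultimately show ?thesis
    unfolding flow_def by blast
qed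

text \<open>Lets facts about omega-limit sets be read off from their alpha counterparts for the
  reversed flow.\<close>

lemma omega_limit_reverse: "omega_limit M v x = alpha_limit M (\<lambda>t. v (- t)) x"
proof -
  have tail: "{v t x |t. t > n} = {v (- t) x |t. t < - n}" for n
  proof -
    have "{v t x |t. t > n} = (\<lambda>t. v t x) ` {n<..}"
      by auto
    also have "{n<..} = uminus ` {..<- n}"
      by simp
    also have "(\<lambda>t. v t x) ` \<dots> = {v (- t) x |t. t < - n}"
      unfolding image_image by blast
    finally show ?thesis .
  qed
  have "omega_limit M v x = (\<Inter>n. M closure_of {v (- t) x |t. t < - n})"
    unfolding omega_limit_def tail ..
  \<comment> \<open>Reindexing by \<open>uminus\<close>: since it is surjective, the bounds
    \<open>- n\<close> run through all reals.\<close>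
  also have "\<dots> = \<Inter> ((\<lambda>n. M closure_of {v (- t) x |t. t < n}) ` range uminus)"
    unfolding image_image ..
  finally show ?thesis
    unfolding alpha_limit_def surj_uminus .
qed

lemma orbit_reverse: "orbit (\<lambda>t. v (- t)) x = orbit v x"
proof -
  have "range (\<lambda>t. v (- t) x) = (\<lambda>t. v t x) ` range uminus"
    unfolding image_image ..
  then show ?thesis
    unfolding orbit_def surj_uminus .
qed

section \<open>Limit sets versus orbits\<close>

lemma alpha_limit_invariant:
  assumes "flow M v" "x \<in> topspace M" "p \<in> alpha_limit M v x"
  shows "v s p \<in> alpha_limit M v x"
  unfolding alpha_limit_def
proof (rule INT_I)
  fix n
  \<comment> \<open>Flowing for time \<open>s\<close> shifts the tail before \<open>n - s\<close> to
    the tail before \<open>n\<close>; continuity of \<open>v s\<close> carries this over to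
    closures.\<close>
  have "v s ` {v t x |t. t < n - s} \<subseteq> {v t x |t. t < n}"
    using assms(1,2) unfolding flow_def
    by clarsimp (metis add.commute less_diff_eq)
  moreover have "v s ` (M closure_of {v t x |t. t < n - s}) \<subseteq> M closure_of (v s ` {v t x |t. t < n - s})"
    by (rule continuous_map_image_closure_subset[OF flow_continuous_map[OF assms(1)]])
  moreover have "p \<in> M closure_of {v t x |t. t < n - s}"
    using assms(3) unfolding alpha_limit_def by blast
  ultimately show "v s p \<in> M closure_of {v t x |t. t < n}"
    using closure_of_mono by blast
qed

lemma alpha_limit_disjoint_orbit:
  assumes "flow M v" "x \<in> topspace M" "x \<notin> alpha_limit M v x"
  shows "alpha_limit M v x \<inter> orbit v x = {}"
proof (rule ccontr)
  assume "alpha_limit M v x \<inter> orbit v x \<noteq> {}"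
  then obtain t where "v t x \<in> alpha_limit M v x"
    by (auto simp: orbit_def)
  \<comment> \<open>Invariance lets the common point flow back to \<open>x\<close> inside the limit
    set.\<close>
  then have "v (- t) (v t x) \<in> alpha_limit M v x"
    by (rule alpha_limit_invariant[OF assms(1,2)])
  moreover have "v (- t) (v t x) = x"
    using assms(1,2) unfolding flow_def by (metis add.left_inverse)
  ultimately show False
    using assms(3) by simp
qed

lemma omega_limit_disjoint_orbit:
  assumes "flow M v" "x \<in> topspace M" "x \<notin> omega_limit M v x"
  shows "omega_limit M v x \<inter> orbit v x = {}"
  using alpha_limit_disjoint_orbit[OF flow_reverse[OF assms(1)] assms(2)] assms(3)
  unfolding omega_limit_reverse[of M v x] orbit_reverse by blast

lemma limit'_NonRec:
  assumes "flow M v" "x \<in> NonRec M v"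
  shows "alpha_limit' M v x = alpha_limit M v x" "omega_limit' M v x = omega_limit M v x"
  using assms alpha_limit_disjoint_orbit[OF assms(1)] omega_limit_disjoint_orbit[OF assms(1)]
  by (auto simp: NonRec_def recurrent_def alpha_limit'_def omega_limit'_def)

text \<open>A period \<open>T\<close> gives \<open>v (- T) x = x\<close>; iteration yields the
  return times \<open>- (real k * T)\<close>, which are unbounded below.\<close>

lemma Per_arbitrarily_negative_return:
  assumes "flow M v" "x \<in> Per M v"
  shows "\<exists>t<n. v t x = x"
proof -
  from assms(2) obtain T where T: "T > 0" "v T x = x" and x: "x \<in> topspace M"
    by (auto simp: Per_def has_period_def)
  have add: "v (s + t) x = v s (v t x)" and zero: "v 0 x = x" for s t
    using assms(1) x unfolding flow_def by auto
  have ret: "v (- T) x = x"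
    using add[of "- T" T] T zero by simp
  have "v (- (real k * T)) x = x" for k
  proof (induction k)
    case (Suc k)
    then show ?case
      using add[of "- T" "- (real k * T)"] ret by (simp add: algebra_simps)
  qed (simp add: zero)
  moreover obtain k where "- n < real k * T"
    using ex_less_of_nat_mult[OF T(1)] by blast
  ultimately show ?thesis
    by (metis minus_less_iff)
qed

lemma Per_in_alpha_limit:
  assumes "flow M v" "x \<in> Per M v"
  shows "x \<in> alpha_limit M v x"
  unfolding alpha_limit_def
proof (rule INT_I)
  fix n
  have "x \<in> {v t x |t. t < n}"
    using Per_arbitrarily_negative_return[OF assms, of n] by force
  moreover have "x \<in> topspace M"
    using assms(2) by (simp add: Per_def)
  ultimately show "x \<in> M closure_of {v t x |t. t < n}"
    using closure_of_subset_Int[of M "{v t x |t. t < n}"] by (meson IntI subsetD)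
qed

section \<open>Finiteness of the singular set\<close>

lemma orbit_Sing: "x \<in> Sing M v \<Longrightarrow> orbit v x = {x}"
  by (auto simp: Sing_def orbit_def)

lemma Sing_subset_nonwandering_set: "Sing M v \<subseteq> nonwandering_set M v"
proof
  fix x assume x: "x \<in> Sing M v"
  \<comment> \<open>The fixed point \<open>x\<close> lies in both sets, so time \<open>N + 1\<close>
    refutes every candidate bound \<open>N\<close>.\<close>
  have "v (N + 1) ` U \<inter> U \<noteq> {}" if "x \<in> U" for U N
    using x that by (force simp: Sing_def)
  then have "\<not> wandering M v x"
    unfolding wandering_def by (meson less_add_one)
  then show "x \<in> nonwandering_set M v"
    using x by (simp add: nonwandering_set_def Sing_def)
qed

text \<open>Singular points are nonwandering, and an orbit through one is a singleton, so
  \<open>Sing M v\<close> injects into the finite family \<C>.\<close>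

lemma finite_Sing_if_nonwandering_set_closed_orbits:
  assumes "flow M v" "finite \<C>" "\<C> \<subseteq> closed_orbits M v" "nonwandering_set M v = \<Union>\<C>"
  shows "finite (Sing M v)"
proof -
  have "{x} \<in> \<C>" if x: "x \<in> Sing M v" for x
  proof -
    obtain C where C: "C \<in> \<C>" "x \<in> C"
      using subsetD[OF Sing_subset_nonwandering_set x] unfolding assms(4) by (rule UnionE)
    then obtain p where p: "p \<in> topspace M" "C = orbit v p"
      using assms(3) by (auto simp: closed_orbits_def Cl_def Sing_def Per_def)
    then obtain t where t: "x = v t p"
      using C by (auto simp: orbit_def)
    \<comment> \<open>Every point of the orbit of \<open>p\<close> is reached from the singular
      point \<open>v t p\<close>, which does not move.\<close>
    have "v s p = x" for s
    proof -
      have "v s p = v (s - t) (v t p)"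
        using assms(1) p(1) unfolding flow_def by (metis diff_add_cancel)
      then show ?thesis
        using x t by (simp add: Sing_def)
    qed
    then have "C = {x}"
      using p(2) by (auto simp: orbit_def)
    then show ?thesis
      using C by simp
  qed
  then have "(\<lambda>x. {x}) ` Sing M v \<subseteq> \<C>"
    by blast
  then show ?thesis
    using assms(2) by (meson finite_imageD finite_subset inj_on_def singleton_inject)
qed

text \<open>The equivalence maps one-point orbits to one-point orbits, hence embeds
  \<open>Sing M v\<close> in \<open>Sing N w\<close>.\<close>

lemma topologically_equivalent_finite_Sing:
  assumes "topologically_equivalent M v N w" "finite (Sing N w)"
  shows "finite (Sing M v)"
proof -
  from assms(1) obtain h where h: "homeomorphic_map M N h"
    and orb: "\<And>x. x \<in> topspace M \<Longrightarrow> h ` orbit v x = orbit w (h x)"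
    unfolding topologically_equivalent_def by blast
  have "h x \<in> Sing N w" if x: "x \<in> Sing M v" for x
  proof -
    have "x \<in> topspace M"
      using x by (simp add: Sing_def)
    then have "orbit w (h x) = {h x}" "h x \<in> topspace N"
      using orb[of x] orbit_Sing[OF x] h homeomorphic_imp_surjective_map[OF h] by auto
    then show ?thesis
      by (auto simp: Sing_def orbit_def)
  qed
  moreover have "inj_on h (Sing M v)"
    using homeomorphic_imp_injective_map[OF h] by (rule inj_on_subset) (auto simp: Sing_def)
  ultimately show ?thesis
    using assms(2) by (meson finite_subset image_subsetI inj_on_finite)
qed

lemma finite_Sing_morse_smale_flow:
  assumes "morse_smale_flow TYPE('e::real_normed_vector) M v"
  shows "finite (Sing M v)"
proof -
  from assms obtain N and A :: "('a, 'e) chart set" and X w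
    where "flow M v" "smooth_morse_smale N A X w" "topologically_equivalent M v N w"
    unfolding morse_smale_flow_def by blast
  then show ?thesis
    using topologically_equivalent_finite_Sing finite_Sing_if_nonwandering_set_closed_orbits
    unfolding smooth_morse_smale_def flow_of_vector_field_def by metis
qed

section \<open>Limit sets along an abstract weak orbit\<close>

lemma connectedin_finite_t1_space_eq:
  assumes "t1_space M" "connectedin M S" "finite S" "x \<in> S" "y \<in> S"
  shows "x = y"
proof -
  \<comment> \<open>A finite T1 space is discrete, and a connected discrete space has at most one
    point.\<close>
  have "subtopology M S = discrete_topology S"
    using assms by (metis connectedin_subset_topspace finite_t1_space_imp_discrete_topology
        t1_space_subtopology topspace_subtopology_subset)
  then have "connected_space (discrete_topology S)"
    using assms(2) by (simp add: connectedin_def)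
  then show ?thesis
    using assms(4,5) by (auto simp: connected_space_discrete_topology)
qed

lemma weak_class''_subset: "weak_class'' M v x \<subseteq> weak_class' M v x \<inter> point_kind M v x"
  unfolding weak_class''_def
  using connected_component_of_subset_topspace[of "subtopology M (weak_class' M v x \<inter> point_kind M v x)"]
  by auto

lemma weak_class'_limits:
  assumes "y \<in> weak_class' M v x"
  shows "alpha_limit' M v y = alpha_limit' M v x" "omega_limit' M v y = omega_limit' M v x"
  using assms
    connected_component_of_subset_topspace[of "subtopology M {y \<in> topspace M.
      alpha_limit' M v y = alpha_limit' M v x \<and> omega_limit' M v y = omega_limit' M v x}" x]
  unfolding weak_class'_def by auto

lemma abstract_weak_orbit_self:
  assumes "x \<in> topspace M"
  shows "x \<in> abstract_weak_orbit M v x"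
proof (cases "x \<in> Rec M v")
  case True
  then show ?thesis
    using assms by (simp add: abstract_weak_orbit_def check_orbit_def)
next
  case False
  have "x \<in> weak_class' M v x"
    using assms by (simp add: weak_class'_def connected_component_of_refl)
  \<comment> \<open>Outside \<open>Rec\<close> a recurrent point is in \<open>Cl\<close>, so the
    last branch of \<open>point_kind\<close> is not reached.\<close>
  moreover have "x \<in> point_kind M v x"
    using assms False by (auto simp: point_kind_def NonRec_def Rec_def Cl_def)
  ultimately show ?thesis
    using assms False by (simp add: abstract_weak_orbit_def weak_class''_def connected_component_of_refl)
qed

lemma abstract_weak_orbit_Sing:
  assumes "t1_space M" "finite (Sing M v)" "x \<in> Sing M v" "y \<in> abstract_weak_orbit M v x"
  shows "y = x"
proof -
  have x: "x \<in> topspace M" "x \<notin> Rec M v"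
    using assms(3) by (auto simp: Sing_def Rec_def Cl_def)
  then have eq: "abstract_weak_orbit M v x = weak_class'' M v x"
    by (simp add: abstract_weak_orbit_def)
  have "connectedin M (weak_class'' M v x)"
    unfolding weak_class''_def
    by (meson connectedin_connected_component_of connectedin_subtopology)
  moreover have "finite (weak_class'' M v x)"
    using weak_class''_subset[of M v x] assms(2,3)
    by (auto simp: point_kind_def intro: finite_subset)
  ultimately show ?thesis
    using connectedin_finite_t1_space_eq[OF assms(1)] abstract_weak_orbit_self[OF x(1), of v]
      assms(4) eq by metis
qed

text \<open>As \<open>Sing\<close> and \<open>Per\<close> are disjoint, the second condition on
  \<open>x\<close> says that it is not periodic. Periodic points must be excluded: an annulus of
  periodic orbits can form one class although their limit sets differ.\<close>

lemma abstract_weak_orbit_limits: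
  assumes "flow M v" "t1_space M" "finite (Sing M v)"
    and "x \<in> topspace M" "x \<in> Per M v \<Longrightarrow> x \<in> Sing M v" "y \<in> abstract_weak_orbit M v x"
  shows "y \<in> topspace M \<and> alpha_limit M v y = alpha_limit M v x \<and>
    omega_limit M v y = omega_limit M v x"
proof -
  consider "x \<in> Sing M v" | "x \<in> Rec M v" | "x \<notin> Cl M v" "x \<notin> Rec M v"
    using assms(5) by (auto simp: Cl_def)
  then show ?thesis
  proof cases
    case 1
    then show ?thesis
      using abstract_weak_orbit_Sing[OF assms(2,3) _ assms(6)] assms(4) by simp
  next
    case 2
    then show ?thesis
      using assms(6) by (simp add: abstract_weak_orbit_def check_orbit_def)
  next
    case 3
    then have x: "x \<in> NonRec M v" and "point_kind M v x = NonRec M v"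
      using assms(4) by (auto simp: NonRec_def Rec_def Cl_def point_kind_def)
    \<comment> \<open>The class stays within \<open>NonRec\<close>, so priming changes the limit
      sets of neither \<open>x\<close> nor \<open>y\<close>.\<close>
    then have y: "y \<in> NonRec M v" "y \<in> weak_class' M v x"
      using assms(6) weak_class''_subset[of M v x] 3(2) by (auto simp: abstract_weak_orbit_def)
    then show ?thesis
      using weak_class'_limits[OF y(2)] limit'_NonRec[OF assms(1) x] limit'_NonRec[OF assms(1) y(1)]
      by (simp add: NonRec_def)
  qed
qed

text \<open>Lying in the unstable set of a singular point rules out periodicity, so the whole class
  of \<open>y\<close> shares both limit sets. This is why the stable inclusion also starts from an
  unstable set.\<close>

lemma abstract_weak_orbit_subset_stable_unstable:
  assumes "flow M v" "t1_space M" "finite (Sing M v)" "x \<in> Sing M v" "y \<in> unstable_set M v {x}"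
  shows "abstract_weak_orbit M v y \<subseteq> unstable_set M v {x}"
    and "y \<in> stable_set M v D \<Longrightarrow> abstract_weak_orbit M v y \<subseteq> stable_set M v D"
proof -
  have y: "y \<in> topspace M" "alpha_limit M v y \<subseteq> {x}"
    using assms(5) by (auto simp: unstable_set_def)
  \<comment> \<open>A periodic \<open>y\<close> is in its own alpha-limit set, which is inside
    \<open>{x}\<close>; hence \<open>y = x\<close>.\<close>
  have "y \<in> Sing M v" if "y \<in> Per M v"
    using subsetD[OF y(2) Per_in_alpha_limit[OF assms(1) that]] assms(4) by simp
  note lim = abstract_weak_orbit_limits[OF assms(1-3) y(1) this]
  show "abstract_weak_orbit M v y \<subseteq> unstable_set M v {x}"
    using lim y(2) by (auto simp: unstable_set_def)
  show "abstract_weak_orbit M v y \<subseteq> stable_set M v D" if "y \<in> stable_set M v D"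
    using lim that by (auto simp: stable_set_def)
qed

lemma union_of_abstract_weak_orbits:
  assumes "S \<subseteq> topspace M" "\<And>y. y \<in> S \<Longrightarrow> abstract_weak_orbit M v y \<subseteq> S"
  shows "\<exists>\<C> \<subseteq> abstract_weak_orbit_space M v. S = \<Union>\<C>"
proof (intro exI conjI)
  show "abstract_weak_orbit M v ` S \<subseteq> abstract_weak_orbit_space M v"
    using assms(1) by (auto simp: abstract_weak_orbit_space_def)
  \<comment> \<open>The classes cover \<open>S\<close> because each point lies in its own
    class.\<close>
  show "S = \<Union> (abstract_weak_orbit M v ` S)"
    using assms abstract_weak_orbit_self by fast
qed

theorem theorem7p5:
  fixes M :: "'a topology" and v :: "real \<Rightarrow> 'a \<Rightarrow> 'a"
  assumes "closed_manifold TYPE('e::real_normed_vector) M"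
    and "morse_flow TYPE('e) M v"
  shows "(\<forall>x\<in>Sing M v.
            \<exists>\<C> \<subseteq> abstract_weak_orbit_space M v. unstable_set M v {x} = \<Union>\<C>) \<and>
         (\<forall>x\<in>Sing M v. \<forall>y\<in>Sing M v.
            \<exists>\<C> \<subseteq> abstract_weak_orbit_space M v.
              unstable_set M v {x} \<inter> stable_set M v {y} = \<Union>\<C>)"
proof -
  have ms: "morse_smale_flow TYPE('e) M v"
    using assms(2) by (simp add: morse_flow_def)
  then have fl: "flow M v"
    by (simp add: morse_smale_flow_def)
  have fin: "finite (Sing M v)"
    by (rule finite_Sing_morse_smale_flow[OF ms])
  have t1: "t1_space M"
    using assms(1) by (auto simp: closed_manifold_def Hausdorff_imp_t1_space)
  note sub = abstract_weak_orbit_subset_stable_unstable[OF fl t1 fin]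
  show ?thesis
    \<comment> \<open>For a connecting set, the class of each point stays in the unstable and in the
      stable set.\<close>
    by (intro conjI ballI union_of_abstract_weak_orbits)
      (use sub in \<open>auto simp: unstable_set_def stable_set_def\<close>)
qed

end
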